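(* For arbitrarily large positive integers $n$, there is a set $A\subseteq\{1,\ldots,2\cdot 16^n\}$ with $|A|=2^n$ such that \[R_2(A-A)\leq 3\] and \[C(A-A)\leq 2n.\]
   Context: $A-A=\{a-a':a,a'\in A\}$. A finite increasing sequence $a_1<\cdots<a_n$ is strictly convex if the sequence of first differences $a_{i+1}-a_i$ is strictly monotone; $C(B)$ denotes the length of the longest strictly convex sequence contained in $B$. For $L\geq 1$, a finite increasing sequence of real numbers $a_1<\cdots<a_n$ is called $L$-regular if there is a positive real number $X$ such that $X\leq a_{i+1}-a_i\leq LX$ for all $i=1,\ldots,n-1$. For a set $B$ of real numbers, $R_L(B)=\max\{|B'|:B'\subseteq B,\ B'\text{ is }L\text{-regular}\}$. *)

theory Defs
  imports Complex_Main
begin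

definition difference_set :: "real set \<Rightarrow> real set" where
  "difference_set A = {a - a' | a a'. a \<in> A \<and> a' \<in> A}"

definition first_differences :: "real list \<Rightarrow> real list" where
  "first_differences xs = map2 (\<lambda>x y. y - x) xs (tl xs)"

text \<open>Strictly monotone means strictly increasing or strictly decreasing, so the sequences
  usually called strictly concave are included.  Sequences with at most two terms qualify
  vacuously.\<close>

definition strictly_convex :: "real list \<Rightarrow> bool" where
  "strictly_convex xs \<longleftrightarrow> sorted_wrt (<) xs \<and>
     (sorted_wrt (<) (first_differences xs) \<or> sorted_wrt (>) (first_differences xs))"

text \<open>Intended for \<open>L \<ge> 1\<close>.\<close>

definition regular :: "real \<Rightarrow> real list \<Rightarrow> bool" where
  "regular L xs \<longleftrightarrow> sorted_wrt (<) xs \<and>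
     (\<exists>X>0. \<forall>d \<in> set (first_differences xs). X \<le> d \<and> d \<le> L * X)"

text \<open>The two maxima below are meaningful for finite \<open>B\<close>: then they range over finite nonempty
  sets of natural numbers.  For infinite \<open>B\<close> the maximum may not exist and \<open>Max\<close> is unspecified.\<close>

definition R :: "real \<Rightarrow> real set \<Rightarrow> nat" where
  "R L B = Max {card B' | B'. B' \<subseteq> B \<and> finite B' \<and> regular L (sorted_list_of_set B')}"

definition C :: "real set \<Rightarrow> nat" where
  "C B = Max {length xs | xs. set xs \<subseteq> B \<and> strictly_convex xs}"

end

theory Submission
  imports Defs
begin

text \<open>Take for \<open>A\<close> the numbers whose base-16 digits are all 0 or 1, shifted by 1.  The differences
  have digits in \<open>{-1, 0, 1}\<close>, so according to the leading digit they fall into three clusters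
  which are translates of the same set for \<open>n - 1\<close> and whose distances exceed twice their diameters.
  A 2-regular sequence that changes cluster must change cluster at every step, so it has at most
  three terms; otherwise it lives in one cluster and induction applies.  A sequence with increasing
  differences that changes cluster once must do so at every later step, so all but its last two
  terms lie in one cluster, whence the bound grows by 2 with each digit.  Decreasing differences
  reduce to increasing ones by reflection, because \<open>A - A\<close> is symmetric.\<close>

section \<open>Integers with base-16 digits 0 and 1\<close>

fun digit_set :: "nat \<Rightarrow> int set" where
  "digit_set 0 = {1}"
| "digit_set (Suc n) = digit_set n \<union> (\<lambda>a. a + 16 ^ n) ` digit_set n"

definition digit_diffs :: "nat \<Rightarrow> real set" where
  "digit_diffs n = difference_set (real_of_int ` digit_set n)"

lemma finite_digit_set: "finite (digit_set n)"
  by (induction n) auto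

text \<open>The largest element is 1 plus the geometric sum (16^n - 1)/15; the factor 15 clears the
  denominator.\<close>

lemma digit_set_bounds:
  assumes "a \<in> digit_set n"
  shows "1 \<le> a" "15 * a \<le> 16 ^ n + 14"
  using assms
proof (induction n arbitrary: a)
  case (Suc n)
  { case 1 then show ?case using Suc by (auto intro: add_increasing2) }
  { case 2
    then obtain b where "b \<in> digit_set n" "a = b \<or> a = b + 16 ^ n" by auto
    then show ?case using Suc(2)[of b] zero_le_power[of "16::int" n] by (auto simp del: zero_le_power) }
qed auto

lemma digit_set_subset: "digit_set n \<subseteq> {1..16 ^ n}"
proof
  fix a assume "a \<in> digit_set n"
  from digit_set_bounds[OF this] one_le_power[of "16::int" n] show "a \<in> {1..16 ^ n}"
    by simp
qed

lemma card_digit_set: "card (digit_set n) = 2 ^ n"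
proof (induction n)
  case (Suc n)
  \<comment> \<open>Elements are at least 1, so those of the translate exceed 16^n, which the
    original ones do not.\<close>
  have "digit_set n \<inter> (\<lambda>a. a + 16 ^ n) ` digit_set n = {}"
  proof -
    have "a + 16 ^ n \<notin> digit_set n" if "a \<in> digit_set n" for a
      using subsetD[OF digit_set_subset, of a n] subsetD[OF digit_set_subset, of "a + 16 ^ n" n] that
      by auto
    then show ?thesis by blast
  qed
  then show ?case
    using Suc by (simp add: card_Un_disjoint finite_digit_set card_image inj_on_def)
qed simp

section \<open>The difference set and its clusters\<close>

lemma digit_diffs_uminus: "x \<in> digit_diffs n \<Longrightarrow> - x \<in> digit_diffs n"
  unfolding digit_diffs_def difference_set_def by force

lemma digit_diffs_0: "digit_diffs 0 = {0}"
  by (auto simp: digit_diffs_def difference_set_def)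

lemma digit_diffs_bound:
  assumes "x \<in> digit_diffs n"
  shows "15 * \<bar>x\<bar> \<le> 16 ^ n"
proof -
  obtain a b where ab: "a \<in> digit_set n" "b \<in> digit_set n" "x = real_of_int (a - b)"
    using assms by (auto simp: digit_diffs_def difference_set_def)
  have "15 * \<bar>a - b\<bar> \<le> 16 ^ n"
    using digit_set_bounds[OF ab(1)] digit_set_bounds[OF ab(2)] by (simp add: abs_if)
  then have "real_of_int (15 * \<bar>a - b\<bar>) \<le> real_of_int (16 ^ n)"
    by (simp only: of_int_le_iff)
  then show ?thesis by (simp add: ab(3))
qed

text \<open>Here \<open>c\<close> is the difference of the two leading digits and \<open>d\<close>
  that of the remaining parts.\<close>

lemma digit_diffs_Suc:
  assumes "x \<in> digit_diffs (Suc n)"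
  shows "\<exists>c::int. \<exists>d \<in> digit_diffs n. -1 \<le> c \<and> c \<le> 1 \<and> x = of_int c * 16 ^ n + d"
proof -
  obtain a b where a: "a \<in> digit_set (Suc n)" and b: "b \<in> digit_set (Suc n)"
    and x: "x = real_of_int a - real_of_int b"
    using assms by (auto simp: digit_diffs_def difference_set_def)
  obtain a' e where a': "a' \<in> digit_set n" "e = 0 \<or> e = (1::int)" "a = a' + e * 16 ^ n"
    using a by force
  obtain b' e' where b': "b' \<in> digit_set n" "e' = 0 \<or> e' = (1::int)" "b = b' + e' * 16 ^ n"
    using b by force
  have "real_of_int a' - real_of_int b' \<in> digit_diffs n"
    using a' b' by (auto simp: digit_diffs_def difference_set_def)
  moreover have "x = of_int (e - e') * 16 ^ n + (real_of_int a' - real_of_int b')"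
    using x a' b' by (simp add: algebra_simps)
  moreover have "-1 \<le> e - e'" "e - e' \<le> 1" using a' b' by auto
  ultimately show ?thesis by blast
qed

text \<open>Offsets within a cluster are at most M/15 in absolute value. Hence a step inside a
  cluster is at most 2M/15, and a step between clusters at least M - 2M/15 = 13M/15.\<close>

lemma cluster_step:
  fixes c c' :: int and d d' M :: real
  assumes M: "M > 0" and d: "15 * \<bar>d\<bar> \<le> M" "15 * \<bar>d'\<bar> \<le> M"
    and less: "of_int c * M + d < of_int c' * M + d'"
  defines "g \<equiv> (of_int c' * M + d') - (of_int c * M + d)"
  shows "c < c' \<and> 13 * M \<le> 15 * g \<or> c = c' \<and> 15 * g \<le> 2 * M"
proof -
  have g: "g = of_int (c' - c) * M + (d' - d)" by (simp add: g_def algebra_simps)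
  consider "c' - c \<ge> 1" | "c' = c" | "c' - c \<le> -1" by linarith
  then show ?thesis
  proof cases
    case 1
    then have "real_of_int (c' - c) \<ge> 1" by linarith
    then have "1 * M \<le> of_int (c' - c) * M" using M by (intro mult_right_mono) auto
    then have "13 * M \<le> 15 * g" using g d by linarith
    then show ?thesis using 1 by simp
  next
    case 2
    then have "15 * g \<le> 2 * M" using g d by simp
    then show ?thesis using 2 by simp
  next
    case 3
    then have "real_of_int (c' - c) \<le> -1" by linarith
    then have "of_int (c' - c) * M \<le> -1 * M" using M by (intro mult_right_mono) auto
    then have "g < 0" using g d M by linarith
    then show ?thesis using less g_def by linarith
  qed
qed

text \<open>Labels each term with its cluster. The translation \<open>t\<close> lets an induction
  continue inside a single cluster, which is a translate of \<open>digit_diffs n\<close>.\<close>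

lemma digit_diffs_sequence:
  fixes f :: "nat \<Rightarrow> real"
  assumes in_D: "\<And>i. i < m \<Longrightarrow> f i - t \<in> digit_diffs (Suc n)"
    and inc: "\<And>i. Suc i < m \<Longrightarrow> f i < f (Suc i)"
  obtains c :: "nat \<Rightarrow> int" where
    "\<And>i. i < m \<Longrightarrow> -1 \<le> c i \<and> c i \<le> 1"
    "\<And>i. i < m \<Longrightarrow> f i - (t + of_int (c i) * 16 ^ n) \<in> digit_diffs n"
    "\<And>i. Suc i < m \<Longrightarrow> c i < c (Suc i) \<and> 13 * 16 ^ n \<le> 15 * (f (Suc i) - f i) \<or>
       c i = c (Suc i) \<and> 15 * (f (Suc i) - f i) \<le> 2 * 16 ^ n"
proof -
  have "\<forall>i\<in>{..<m}. \<exists>c::int. -1 \<le> c \<and> c \<le> 1 \<and> f i - (t + of_int c * 16 ^ n) \<in> digit_diffs n"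
  proof
    fix i assume "i \<in> {..<m}"
    then obtain c :: int and d where "d \<in> digit_diffs n" "-1 \<le> c" "c \<le> 1"
      "f i - t = of_int c * 16 ^ n + d"
      using digit_diffs_Suc[OF in_D[of i]] by auto
    moreover from this have "d = f i - (t + of_int c * 16 ^ n)" by simp
    ultimately show "\<exists>c::int. -1 \<le> c \<and> c \<le> 1 \<and> f i - (t + of_int c * 16 ^ n) \<in> digit_diffs n"
      by metis
  qed
  then obtain c :: "nat \<Rightarrow> int" where c: "\<And>i. i < m \<Longrightarrow>
      -1 \<le> c i \<and> c i \<le> 1 \<and> f i - (t + of_int (c i) * 16 ^ n) \<in> digit_diffs n"
    by (metis bchoice lessThan_iff)
  show thesis
  proof (rule that)
    fix i assume i: "Suc i < m"
    let ?d = "\<lambda>i. f i - (t + of_int (c i) * 16 ^ n)"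
    have "15 * \<bar>?d i\<bar> \<le> 16 ^ n" "15 * \<bar>?d (Suc i)\<bar> \<le> 16 ^ n"
      using c i by (blast intro: digit_diffs_bound Suc_lessD)+
    from cluster_step[OF _ this, of "c i" "c (Suc i)"] inc[OF i]
    show "c i < c (Suc i) \<and> 13 * 16 ^ n \<le> 15 * (f (Suc i) - f i) \<or>
       c i = c (Suc i) \<and> 15 * (f (Suc i) - f i) \<le> 2 * 16 ^ n"
      by (simp add: algebra_simps)
  qed (use c in auto)
qed

section \<open>Regular and convex sequences across clusters\<close>

lemma digit_diffs_no_regular:
  fixes f :: "nat \<Rightarrow> real"
  assumes "\<And>i. i < 4 \<Longrightarrow> f i - t \<in> digit_diffs n" and "X > 0"
    and "\<And>i. i < 3 \<Longrightarrow> X \<le> f (Suc i) - f i \<and> f (Suc i) - f i \<le> 2 * X"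
  shows False
  using assms
proof (induction n arbitrary: t)
  case 0
  then have "f 0 = t" "f 1 = t" using 0(1)[of 0] 0(1)[of 1] by (auto simp: digit_diffs_0)
  then show ?case using 0(2) 0(3)[of 0] by simp
next
  case (Suc n)
  have inc: "f i < f (Suc i)" if "Suc i < 4" for i
    using Suc.prems(2) Suc.prems(3)[of i] that by linarith
  obtain c :: "nat \<Rightarrow> int" where c: "\<And>i. i < 4 \<Longrightarrow> -1 \<le> c i \<and> c i \<le> 1"
    and D: "\<And>i. i < 4 \<Longrightarrow> f i - (t + of_int (c i) * 16 ^ n) \<in> digit_diffs n"
    and step: "\<And>i. Suc i < 4 \<Longrightarrow> c i < c (Suc i) \<and> 13 * 16 ^ n \<le> 15 * (f (Suc i) - f i) \<or>
       c i = c (Suc i) \<and> 15 * (f (Suc i) - f i) \<le> 2 * 16 ^ n"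
    using digit_diffs_sequence[of 4 f t n, OF Suc.prems(1) inc] by blast
  have M: "(0::real) < 16 ^ n" by simp
  show ?case
  proof (cases "\<exists>i<3. c i < c (Suc i)")
    case True
    then obtain i where "i < 3" "c i < c (Suc i)" by blast
    then have "13 * 16 ^ n \<le> 30 * X" using step[of i] Suc.prems(3)[of i] by auto
    \<comment> \<open>One jump is at most 2X, so already X is larger than any step inside a cluster;
      hence all three steps are jumps.\<close>
    then have X: "2 * 16 ^ n < 15 * X" using M by linarith
    have "c i < c (Suc i)" if "i < 3" for i
      using step[of i] Suc.prems(3)[of i] X that by auto
    \<comment> \<open>Four strictly increasing labels do not fit into {-1, 0, 1}.\<close>
    from this[of 0] this[of 1] this[of 2] c[of 0] c[of 3] show False
      by (simp add: numeral_2_eq_2 numeral_3_eq_3)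
  next
    case False
    have "c i = c 0" if "i < 4" for i
      using that
    proof (induction i)
      case (Suc i) then show ?case using False step[of i] by auto
    qed simp
    then show False using Suc.IH[of "t + of_int (c 0) * 16 ^ n"] D Suc.prems(2,3) by metis
  qed
qed

text \<open>Each digit contributes at most two terms. The induction effectively starts at one digit,
  since for n = 0 a single term already exceeds the bound 0.\<close>

lemma digit_diffs_increasing_gaps:
  fixes f :: "nat \<Rightarrow> real"
  assumes "\<And>i. i < m \<Longrightarrow> f i - t \<in> digit_diffs n"
    and "\<And>i. Suc i < m \<Longrightarrow> f i < f (Suc i)"
    and "\<And>i. Suc (Suc i) < m \<Longrightarrow> f (Suc i) - f i < f (Suc (Suc i)) - f (Suc i)"
    and "n > 0"
  shows "m \<le> 2 * n"
  using assms
proof (induction n arbitrary: m t)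
  case (Suc n)
  obtain c :: "nat \<Rightarrow> int" where c: "\<And>i. i < m \<Longrightarrow> -1 \<le> c i \<and> c i \<le> 1"
    and D: "\<And>i. i < m \<Longrightarrow> f i - (t + of_int (c i) * 16 ^ n) \<in> digit_diffs n"
    and step: "\<And>i. Suc i < m \<Longrightarrow> c i < c (Suc i) \<and> 13 * 16 ^ n \<le> 15 * (f (Suc i) - f i) \<or>
       c i = c (Suc i) \<and> 15 * (f (Suc i) - f i) \<le> 2 * 16 ^ n"
    using digit_diffs_sequence[of m f t n, OF Suc.prems(1,2)] by blast
  have M: "(0::real) < 16 ^ n" by simp
  note gap = Suc.prems(3)
  show ?case
  proof (cases "n = 0")
    case True
    show ?thesis
    proof (rule ccontr)
      assume "\<not> ?thesis"
      \<comment> \<open>With one digit the differences are -1, 0, 1; three increasing terms use them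
        all and have equal gaps.\<close>
      then have m: "2 < m" using True by simp
      then have f: "f i = t + of_int (c i)" if "i \<le> 2" for i
        using D[of i] that True by (auto simp: digit_diffs_0)
      have "c 0 < c 1" "c 1 < c 2"
        using Suc.prems(2)[of 0] Suc.prems(2)[of 1] f m by (auto simp: numeral_2_eq_2)
      moreover have "-1 \<le> c 0" "c 2 \<le> 1" using c m by auto
      ultimately have "c 0 = -1" "c 1 = 0" "c 2 = 1" by linarith+
      then show False using Suc.prems(3)[of 0] f[of 0] f[of 1] f[of 2] m
        by (simp add: numeral_2_eq_2)
    qed
  next
    case False
    \<comment> \<open>A change of label at a step followed by two more steps would force jumps there
      too, as the gaps increase, and so give four distinct labels.\<close>
    have same: "c i = c 0" if "i < m - 2" for i
      using that
    proof (induction i)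
      case (Suc i)
      have i: "Suc (Suc (Suc i)) < m" using Suc.prems by simp
      have "c (Suc i) = c i"
      proof (rule ccontr)
        assume "c (Suc i) \<noteq> c i"
        then have 1: "c i < c (Suc i)" "13 * 16 ^ n \<le> 15 * (f (Suc i) - f i)"
          using step[of i] i by auto
        then have jump: "2 * 16 ^ n < 15 * (f (Suc i) - f i)" using M by linarith
        have 2: "c (Suc i) < c (Suc (Suc i))"
          using step[of "Suc i"] Suc_lessD[OF i] jump gap[of i]
          by auto
        have "c (Suc (Suc i)) < c (Suc (Suc (Suc i)))"
          using step[of "Suc (Suc i)"] i jump
            gap[of i] gap[of "Suc i"]
          by auto
        with 1 2 c[of i] c[of "Suc (Suc (Suc i))"] i show False by auto
      qed
      then show ?case using Suc by simp
    qed simp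
    \<comment> \<open>Truncated subtraction does no harm: for m < 2 the bound on m follows as
      well.\<close>
    have "m - 2 \<le> 2 * n"
    proof (rule Suc.IH[of "m - 2" "t + of_int (c 0) * 16 ^ n"])
      show "f i - (t + of_int (c 0) * 16 ^ n) \<in> digit_diffs n" if "i < m - 2" for i
        using D[of i] same[OF that] that by simp
    qed (use Suc.prems False in auto)
    then show ?thesis by simp
  qed
qed simp

section \<open>Transfer to lists and to the two maxima\<close>

lemma length_first_differences: "length (first_differences xs) = length xs - 1"
  by (simp add: first_differences_def)

lemma nth_first_differences:
  "Suc i < length xs \<Longrightarrow> first_differences xs ! i = xs ! Suc i - xs ! i"
  by (simp add: first_differences_def nth_tl)

lemma digit_diffs_strictly_convex:
  assumes xs: "set xs \<subseteq> digit_diffs n" "strictly_convex xs" and n: "n > 0"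
  shows "length xs \<le> 2 * n"
proof -
  let ?m = "length xs"
  have D: "xs ! i \<in> digit_diffs n" if "i < ?m" for i using xs(1) that by auto
  have inc: "xs ! i < xs ! Suc i" if "Suc i < ?m" for i
    using xs(2) that by (simp add: strictly_convex_def sorted_wrt_nth_less)
  consider "sorted_wrt (<) (first_differences xs)" | "sorted_wrt (>) (first_differences xs)"
    using xs(2) strictly_convex_def by blast
  then show ?thesis
  proof cases
    case 1
    have "xs ! Suc i - xs ! i < xs ! Suc (Suc i) - xs ! Suc i" if "Suc (Suc i) < ?m" for i
      using sorted_wrt_nth_less[OF 1, of i "Suc i"] that
      by (simp add: length_first_differences nth_first_differences)
    then show ?thesis
      using digit_diffs_increasing_gaps[of ?m "(!) xs" 0 n] D inc n by simp
  next
    case 2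
    have gap: "xs ! Suc i - xs ! i > xs ! Suc (Suc i) - xs ! Suc i" if "Suc (Suc i) < ?m" for i
      using sorted_wrt_nth_less[OF 2, of i "Suc i"] that
      by (simp add: length_first_differences nth_first_differences)
    show ?thesis
    \<comment> \<open>Negating and reversing keeps the terms increasing and lists the same gaps in
      reverse order, so decreasing gaps become increasing. The index \<open>?m - Suc i\<close> is
      the mirror image of \<open>i\<close>.\<close>
    proof (rule digit_diffs_increasing_gaps[of ?m "\<lambda>i. - xs ! (?m - Suc i)" 0 n])
      show "- xs ! (?m - Suc i) - 0 \<in> digit_diffs n" if "i < ?m" for i
        using digit_diffs_uminus[OF D[of "?m - Suc i"]] that by simp
      show "- xs ! (?m - Suc i) < - xs ! (?m - Suc (Suc i))" if "Suc i < ?m" for i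
        using inc[of "?m - Suc (Suc i)"] that by (simp add: Suc_diff_Suc)
      show "- xs ! (?m - Suc (Suc i)) - - xs ! (?m - Suc i)
          < - xs ! (?m - Suc (Suc (Suc i))) - - xs ! (?m - Suc (Suc i))"
        if "Suc (Suc i) < ?m" for i
        using gap[of "?m - Suc (Suc (Suc i))"] that by (simp add: Suc_diff_Suc)
    qed (rule n)
  qed
qed

text \<open>The first four terms of a longer sequence would already contradict
  \<open>digit_diffs_no_regular\<close>.\<close>

lemma digit_diffs_regular:
  assumes xs: "set xs \<subseteq> digit_diffs n" "regular 2 xs"
  shows "length xs \<le> 3"
proof (rule ccontr)
  assume "\<not> ?thesis"
  then have len: "4 \<le> length xs" by simp
  obtain X where X: "X > 0" "\<forall>d \<in> set (first_differences xs). X \<le> d \<and> d \<le> 2 * X"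
    using xs(2) regular_def by blast
  have "X \<le> xs ! Suc i - xs ! i \<and> xs ! Suc i - xs ! i \<le> 2 * X" if "i < 3" for i
  proof -
    have "first_differences xs ! i \<in> set (first_differences xs)"
      using that len by (intro nth_mem) (simp add: length_first_differences)
    then show ?thesis using X(2) that len by (simp add: nth_first_differences)
  qed
  moreover have "xs ! i - 0 \<in> digit_diffs n" if "i < 4" for i
    using xs(1) len that by (auto intro: subsetD[OF _ nth_mem])
  ultimately show False using digit_diffs_no_regular[of "(!) xs" 0 n X] X(1) by blast
qed

text \<open>\<open>Max\<close> requires a finite nonempty set: the bound itself gives finiteness,
  the empty subset a member.\<close>

lemma R_digit_diffs: "R 2 (digit_diffs n) \<le> 3"
proof -
  let ?S = "{card B' | B'. B' \<subseteq> digit_diffs n \<and> finite B' \<and> regular 2 (sorted_list_of_set B')}"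
  have le: "k \<le> 3" if k: "k \<in> ?S" for k
  proof -
    obtain B' where B': "k = card B'" "B' \<subseteq> digit_diffs n" "finite B'"
      "regular 2 (sorted_list_of_set B')"
      using k by blast
    then show ?thesis using digit_diffs_regular[of "sorted_list_of_set B'" n] by simp
  qed
  have "finite ?S" using le by (intro finite_subset[of ?S "{..3}"]) auto
  moreover have "card ({}::real set) \<in> ?S"
    by (intro CollectI exI[of _ "{}"]) (auto simp: regular_def first_differences_def intro: exI[of _ 1])
  ultimately show ?thesis unfolding R_def using le by (subst Max_le_iff) blast+
qed

lemma C_digit_diffs:
  assumes "n > 0"
  shows "C (digit_diffs n) \<le> 2 * n"
proof -
  let ?S = "{length xs | xs. set xs \<subseteq> digit_diffs n \<and> strictly_convex xs}"
  have le: "k \<le> 2 * n" if "k \<in> ?S" for k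
    using that digit_diffs_strictly_convex assms by auto
  have "finite ?S" using le by (intro finite_subset[of ?S "{..2 * n}"]) auto
  moreover have "length ([]::real list) \<in> ?S"
    by (intro CollectI exI[of _ "[]"]) (auto simp: strictly_convex_def first_differences_def)
  ultimately show ?thesis unfolding C_def using le by (subst Max_le_iff) blast+
qed

theorem theorem7:
  "\<forall>N::nat. \<exists>n\<ge>N. n > 0 \<and>
     (\<exists>A::int set. A \<subseteq> {1..2 * 16 ^ n} \<and> card A = 2 ^ n \<and>
        R 2 (difference_set (real_of_int ` A)) \<le> 3 \<and>
        C (difference_set (real_of_int ` A)) \<le> 2 * n)"
proof
  fix N :: nat
  \<comment> \<open>The choice n = \<open>Suc N\<close> ensures both n \<ge> N and n > 0.\<close>
  have "digit_set (Suc N) \<subseteq> {1..2 * 16 ^ Suc N}"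
    using digit_set_subset[of "Suc N"] by fastforce
  then show "\<exists>n\<ge>N. n > 0 \<and>
     (\<exists>A::int set. A \<subseteq> {1..2 * 16 ^ n} \<and> card A = 2 ^ n \<and>
        R 2 (difference_set (real_of_int ` A)) \<le> 3 \<and>
        C (difference_set (real_of_int ` A)) \<le> 2 * n)"
    using card_digit_set R_digit_diffs[unfolded digit_diffs_def] C_digit_diffs[unfolded digit_diffs_def]
    by (intro exI[of _ "Suc N"] conjI exI[of _ "digit_set (Suc N)"])
      (simp_all del: digit_set.simps power_Suc mult_Suc_right)
qed

end
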